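(* Let $G=(V,E)$ be a finite simple graph of order $n\ge 2$, let $f=(B_0,B_1,B_2)$ be any $\gamma_R$-function on $G$, and let $t\ge 2$ be an integer. Let $D_1$ be the set of non-isolated vertices of the induced subgraph $\langle B_1\rangle$, let $D_{12}$ be the set of non-isolated vertices of the induced subgraph $\langle B_1\cup B_2\rangle$, and let $$\theta=\left|\left\{u\in B_1\setminus D_1:\ d_G(u,v)=2 \text{ for some } v\in B_2 \text{ such that } |N_G(v)\cap B_0|=2\right\}\right|.$$ Then $$\gamma_R(S(G,t))\le n^{t-2}\left(n\,\gamma_R(G)-|B_2|-|D_{12}|-\theta+\tfrac12|D_1|\right).$$
   Context: For a finite simple graph $G=(V,E)$ of order $n\ge 2$ and an integer $t\ge1$, let $V^t$ be the set of words of length $t$ over the alphabet $V$; concatenation of words is written by juxtaposition and $x^{k}$ denotes the word $xx\cdots x$ of length $k$. The generalized Sierpiński graph $S(G,t)$ is the graph with vertex set $V^t$ and edge set $\{\{w x y^{r-1}, w y x^{r-1}\}: \{x,y\}\in E,\ r\in\{1,\dots,t\},\ w\in V^{t-r}\}$ (so $S(G,1)=G$). A Roman dominating function on a graph $H$ with vertex set $W$ is a map $f:W\to\{0,1,2\}$ such that every vertex $v$ with $f(v)=0$ has a neighbor $u$ with $f(u)=2$. Its weight is $\sum_{u\in W}f(u)$. The Roman domination number $\gamma_R(H)$ is the minimum weight of a Roman dominating function on $H$; a $\gamma_R$-function is a Roman dominating function of weight $\gamma_R(H)$. One writes $f=(B_0,B_1,B_2)$ where $B_i=\{v: f(v)=i\}$.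 $\langle S\rangle$ denotes the subgraph of $G$ induced by $S$; $d_G$ is the graph distance and $N_G(v)$ the open neighborhood of $v$ in $G$. *)

theory Defs
  imports "Graph_Theory.Graph_Theory"
begin

text \<open>
  A finite simple graph is a \<open>pair_graph\<close>: a finite loop-free symmetric digraph whose arcs are
  ordered pairs, so that an edge \<open>{x, y}\<close> is the pair of arcs \<open>(x, y)\<close>, \<open>(y, x)\<close>.
\<close>

definition words :: "'a set \<Rightarrow> nat \<Rightarrow> 'a list set" where
  "words V k = {w \<in> lists V. length w = k}"

text \<open>
  The two arcs of an edge \<open>{w x y^(r-1), w y x^(r-1)}\<close> arise from \<open>(x, y)\<close> and \<open>(y, x)\<close>.
\<close>

definition sierpinski :: "'a pair_pre_digraph \<Rightarrow> nat \<Rightarrow> 'a list pair_pre_digraph" where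
  "sierpinski G t =
    \<lparr> pverts = words (pverts G) t,
      parcs = {(w @ x # replicate (r - 1) y, w @ y # replicate (r - 1) x) | w x y r.
        (x, y) \<in> parcs G \<and> r \<in> {1..t} \<and> w \<in> words (pverts G) (t - r)} \<rparr>"

text \<open>The values of \<open>f\<close> outside the vertex set are irrelevant.\<close>

definition roman_dominating :: "('a, 'b) pre_digraph \<Rightarrow> ('a \<Rightarrow> nat) \<Rightarrow> bool" where
  "roman_dominating H f \<longleftrightarrow>
    f \<in> verts H \<rightarrow> {0, 1, 2} \<and>
    (\<forall>v \<in> verts H. f v = 0 \<longrightarrow> (\<exists>u \<in> verts H. v \<rightarrow>\<^bsub>H\<^esub> u \<and> f u = 2))"

definition roman_weight :: "('a, 'b) pre_digraph \<Rightarrow> ('a \<Rightarrow> nat) \<Rightarrow> nat" where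
  "roman_weight H f = (\<Sum>u \<in> verts H. f u)"

definition roman_number :: "('a, 'b) pre_digraph \<Rightarrow> nat" where
  "roman_number H = (LEAST k. \<exists>f. roman_dominating H f \<and> roman_weight H f = k)"

definition gamma_R_function :: "('a, 'b) pre_digraph \<Rightarrow> ('a \<Rightarrow> nat) \<Rightarrow> bool" where
  "gamma_R_function H f \<longleftrightarrow> roman_dominating H f \<and> roman_weight H f = roman_number H"

definition nbhd :: "('a, 'b) pre_digraph \<Rightarrow> 'a \<Rightarrow> 'a set" where
  "nbhd H v = {u \<in> verts H. v \<rightarrow>\<^bsub>H\<^esub> u}"

definition non_isolated :: "('a, 'b) pre_digraph \<Rightarrow> 'a set" where
  "non_isolated H = {v \<in> verts H. nbhd H v \<noteq> {}}"

text \<open>Infimum of the lengths of the walks; infinite if there is none.\<close>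

definition graph_dist :: "('a, 'b) pre_digraph \<Rightarrow> 'a \<Rightarrow> 'a \<Rightarrow> ereal" where
  "graph_dist H = wf_digraph.\<mu> H (\<lambda>_. 1)"

lemma pair_graph_sierpinski:
  assumes "pair_graph G"
  shows "pair_graph (sierpinski G t)"
proof -
  interpret pair_graph G by fact
  have fin: "finite (pverts (sierpinski G t))"
    using finite_lists_length_eq[OF pair_finite_verts, of t]
    by (simp add: sierpinski_def words_def lists_eq_set)
  have ends: "x \<in> pverts G \<and> y \<in> pverts G" if "(x, y) \<in> parcs G" for x y
    using that arc_fst_in_verts arc_snd_in_verts by fastforce
  have sub: "parcs (sierpinski G t) \<subseteq> pverts (sierpinski G t) \<times> pverts (sierpinski G t)"
    by (auto simp: sierpinski_def words_def lists_eq_set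
        dest: ends subsetD)
  show ?thesis
  proof
    show "finite (parcs (sierpinski G t))"
      using fin sub by (meson finite_SigmaI finite_subset)
    have "sym (parcs G)"
      using pair_sym_arcs by (simp add: symmetric_def)
    then have "sym (parcs (sierpinski G t))"
      unfolding sierpinski_def sym_def by simp blast
    then show "symmetric (with_proj (sierpinski G t))"
      by (simp add: symmetric_def)
    show "fst e \<noteq> snd e" if "e \<in> parcs (sierpinski G t)" for e
      using that pair_no_loops by (fastforce simp: sierpinski_def)
  qed (use fin sub in auto)
qed

lemma roman_number_attained:
  obtains f where "gamma_R_function H f"
proof -
  have "roman_dominating H (\<lambda>_. 1)"
    by (simp add: roman_dominating_def)
  then have "\<exists>k f. roman_dominating H f \<and> roman_weight H f = k"
    by blast
  from LeastI_ex[OF this] show thesis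
    using that by (auto simp: gamma_R_function_def roman_number_def)
qed

end

theory Submission
  imports Defs
begin

text \<open>
  Let \<open>f\<close> be a minimum Roman dominating function. No edge joins \<open>B1\<close> to \<open>B2\<close>, and the edges
  inside \<open>B1\<close> form a matching. The graph \<open>S(G,t)\<close> is covered by \<open>n ^ (t - 2)\<close> disjoint copies of
  \<open>S(G,2)\<close>, so consider \<open>t = 2\<close>. Give the vertex \<open>xy\<close> the value \<open>f y\<close>; this has weight
  \<open>n \<gamma>\<^sub>R(G)\<close>, and the edges \<open>xy - yx\<close> allow savings at places that do not interfere.

  For \<open>v \<in> B2\<close>, each \<open>vy\<close> with \<open>y \<in> B0\<close> adjacent to \<open>v\<close> is dominated by \<open>yv\<close>. So \<open>vv\<close> can drop to
  \<open>1\<close>, and to \<open>0\<close> if \<open>v\<close> has a neighbour in \<open>B2\<close>. For an edge \<open>uv\<close> inside \<open>B1\<close>, raise \<open>uv\<close> to \<open>2\<close>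
  and drop \<open>uu\<close> and \<open>vu\<close> to \<open>0\<close>. For \<open>u\<close> counted by \<open>\<theta>\<close>, with \<open>v\<close> as in its definition, the common
  neighbour \<open>a\<close> of \<open>u\<close> and \<open>v\<close> lies in \<open>B0\<close>; let \<open>b\<close> be the other vertex of \<open>N(v) \<inter> B0\<close>. Then the
  values \<open>ua = 2\<close>, \<open>ub = 1\<close>, \<open>uu = uv = au = 0\<close> save \<open>1\<close>.
\<close>

section \<open>Minimality of the Roman number, and sums over words\<close>

lemma roman_number_le: "roman_dominating H f \<Longrightarrow> roman_number H \<le> roman_weight H f"
  unfolding roman_number_def by (rule Least_le) blast

text \<open>The additive form avoids truncated subtraction of naturals; iterated, it weighs several
  changes of one function.\<close>

lemma sum_fun_upd:
  fixes f :: "'b \<Rightarrow> nat"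
  assumes "finite A" "x \<in> A"
  shows "sum (f(x := c)) A + f x = sum f A + c"
proof -
  have "sum (f(x := c)) (A - {x}) = sum f (A - {x})"
    by (rule sum.cong) auto
  then show ?thesis
    using sum.remove[OF assms, of f] sum.remove[OF assms, of "f(x := c)"] by simp
qed

lemma sum_of_bool_eq_card:
  assumes "finite V" "A \<subseteq> V"
  shows "(\<Sum>x\<in>V. of_bool (x \<in> A)) = card A"
proof -
  have "(\<Sum>x\<in>V. of_bool (x \<in> A)) = (\<Sum>x\<in>A. (1::nat))"
    using assms by (intro sum.mono_neutral_cong_right) auto
  then show ?thesis by simp
qed

text \<open>A word of length \<open>k + 2\<close> is a free prefix of length \<open>k\<close>
  followed by a pair of letters, so each pair occurs \<open>card V ^ k\<close> times.\<close>

lemma sum_words_last_two: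
  fixes g :: "'b \<Rightarrow> 'b \<Rightarrow> nat"
  assumes "finite V"
  shows "(\<Sum>w\<in>words V (k + 2). g (w ! k) (w ! Suc k)) = card V ^ k * (\<Sum>x\<in>V. \<Sum>y\<in>V. g x y)"
proof -
  have "(\<Sum>w\<in>words V (k + 2). g (w ! k) (w ! Suc k)) =
      (\<Sum>(p, x, y)\<in>words V k \<times> V \<times> V. g x y)"
    by (rule sum.reindex_bij_witness[where i = "\<lambda>(p, x, y). p @ [x, y]"
          and j = "\<lambda>w. (take k w, w ! k, w ! Suc k)"])
      (auto simp: words_def lists_eq_set nth_append subset_iff Cons_nth_drop_Suc[symmetric]
        dest: in_set_takeD intro!: nth_equalityI simp: nth_Cons' less_Suc_eq)
  also have "\<dots> = card (words V k) * (\<Sum>x\<in>V. \<Sum>y\<in>V. g x y)"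
    by (simp add: sum.cartesian_product[symmetric])
  also have "card (words V k) = card V ^ k"
    using card_lists_length_eq[OF assms, of k] by (simp add: words_def lists_eq_set)
  finally show ?thesis .
qed

section \<open>From functions of two letters to Sierpinski graphs\<close>

context pair_graph
begin

lemma arc_sym: "(x, y) \<in> parcs G \<Longrightarrow> (y, x) \<in> parcs G"
  using pair_sym_arcs by (auto simp: symmetric_def dest: symD)

text \<open>The edges with \<open>r = 1\<close> and \<open>r = 2\<close> fix the first
  \<open>k\<close> letters, so a \<open>g\<close> that dominates on pairs dominates every copy of
  \<open>S(G,2)\<close> separately.\<close>

lemma roman_number_sierpinski_le:
  fixes g :: "'a \<Rightarrow> 'a \<Rightarrow> nat"
  assumes g: "\<And>x y. x \<in> pverts G \<Longrightarrow> y \<in> pverts G \<Longrightarrow> g x y \<in> {0, 1, 2}"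
    and dom: "\<And>x y. x \<in> pverts G \<Longrightarrow> y \<in> pverts G \<Longrightarrow> g x y = 0 \<Longrightarrow>
      (\<exists>z. (y, z) \<in> parcs G \<and> g x z = 2) \<or> ((x, y) \<in> parcs G \<and> g y x = 2)"
  shows "roman_number (with_proj (sierpinski G (k + 2))) \<le>
    card (pverts G) ^ k * (\<Sum>x\<in>pverts G. \<Sum>y\<in>pverts G. g x y)"
proof -
  let ?S = "with_proj (sierpinski G (k + 2))"
  let ?F = "\<lambda>w. g (w ! k) (w ! Suc k)"
  have verts: "verts ?S = words (pverts G) (k + 2)"
    by (simp add: sierpinski_def)
  have "roman_dominating ?S ?F"
    unfolding roman_dominating_def
  proof (intro conjI ballI impI funcsetI)
    fix w assume "w \<in> verts ?S"
    then show "?F w \<in> {0, 1, 2}"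
      unfolding verts by (intro g) (auto simp: words_def lists_eq_set)
  next
    fix w assume w: "w \<in> verts ?S" and "?F w = 0"
    define p x y where "p = take k w" and "x = w ! k" and "y = w ! Suc k"
    have len: "length w = k + 2" "set w \<subseteq> pverts G"
      using w unfolding verts by (auto simp: words_def lists_eq_set)
    have w_eq: "w = p @ [x, y]"
      using len by (auto simp: p_def x_def y_def nth_append nth_Cons' less_Suc_eq
          intro!: nth_equalityI)
    have p: "p \<in> words (pverts G) k" and xy: "x \<in> pverts G" "y \<in> pverts G"
      using len by (auto simp: w_eq words_def lists_eq_set)
    have len_p: "length p = k" using p by (simp add: words_def)
    have arcs: "arcs_ends ?S = {(w @ x # replicate (r - 1) y, w @ y # replicate (r - 1) x) | w x y r.
        (x, y) \<in> parcs G \<and> r \<in> {1..k + 2} \<and> w \<in> words (pverts G) (k + 2 - r)}"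
      by (simp add: sierpinski_def)
    have "g x y = 0" using \<open>?F w = 0\<close> by (simp add: x_def y_def)
    from dom[OF xy this] show "\<exists>u\<in>verts ?S. w \<rightarrow>\<^bsub>?S\<^esub> u \<and> ?F u = 2"
    proof (elim disjE exE conjE)
      fix z assume z: "(y, z) \<in> parcs G" "g x z = 2"
      have "(w, p @ [x, z]) \<in> arcs_ends ?S"
        unfolding arcs mem_Collect_eq
        by (rule exI[of _ "p @ [x]"], rule exI[of _ y], rule exI[of _ z], rule exI[of _ 1])
          (use z xy p in \<open>auto simp: w_eq words_def\<close>)
      moreover have "p @ [x, z] \<in> verts ?S" "?F (p @ [x, z]) = 2"
        using z xy p len_p in_arcsD2[OF z(1)] unfolding verts by (auto simp: words_def nth_append)
      ultimately show ?thesis by blast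
    next
      assume z: "(x, y) \<in> parcs G" "g y x = 2"
      have "(w, p @ [y, x]) \<in> arcs_ends ?S"
        unfolding arcs mem_Collect_eq
        by (rule exI[of _ p], rule exI[of _ x], rule exI[of _ y], rule exI[of _ 2])
          (use z xy p in \<open>auto simp: w_eq words_def\<close>)
      moreover have "p @ [y, x] \<in> verts ?S" "?F (p @ [y, x]) = 2"
        using z xy p len_p unfolding verts by (auto simp: words_def nth_append)
      ultimately show ?thesis by blast
    qed
  qed
  from roman_number_le[OF this] show ?thesis
    by (simp only: roman_weight_def verts sum_words_last_two[OF pair_finite_verts])
qed

text \<open>An infimum below 3 is undercut by the cost of some walk, which thus has at most two
  arcs. The first two cases are left to be excluded by the values of \<open>f\<close>.\<close>

lemma graph_dist_2_cases:
  assumes "graph_dist (with_proj G) u v = 2"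
  obtains "u = v" | "(u, v) \<in> parcs G" | w where "(u, w) \<in> parcs G" "(w, v) \<in> parcs G"
proof -
  have "(INF p\<in>{p. awalk u p v}. ereal (awalk_cost (\<lambda>_. 1) p)) < 3"
    using assms by (simp add: graph_dist_def \<mu>_def)
  then obtain p where p: "awalk u p v" "ereal (awalk_cost (\<lambda>_. 1) p) < 3"
    by (auto simp: INF_less_iff)
  have "awalk_cost (\<lambda>_. 1) p = real (length p)"
    by (simp add: awalk_cost_def sum_list_triv)
  with p(2) have "length p < 3" by simp
  then consider "p = []" | e where "p = [e]" | e e' where "p = [e, e']"
    by (cases p rule: list.exhaust) (auto simp: less_Suc_eq numeral_eq_Suc length_Suc_conv)
  then show ?thesis
    by cases (use p that in \<open>auto simp: awalk_simps\<close>)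
qed

end

section \<open>Structure of a minimum Roman dominating function\<close>

locale gamma_R_graph = pair_graph G for G :: "'a pair_pre_digraph" +
  fixes f :: "'a \<Rightarrow> nat"
  assumes gamma_R: "gamma_R_function (with_proj G) f"
begin

lemma f_values: "x \<in> pverts G \<Longrightarrow> f x = 0 \<or> f x = 1 \<or> f x = 2"
  using gamma_R by (auto simp: gamma_R_function_def roman_dominating_def dest!: funcset_mem)

lemma f_dominates:
  assumes "x \<in> pverts G" "f x = 0"
  obtains z where "(x, z) \<in> parcs G" "z \<in> pverts G" "f z = 2"
  using gamma_R assms unfolding gamma_R_function_def roman_dominating_def by auto

lemma f_minimal:
  assumes "\<And>x. x \<in> pverts G \<Longrightarrow> h x \<in> {0, 1, 2}"
    and "\<And>x. x \<in> pverts G \<Longrightarrow> h x = 0 \<Longrightarrow> \<exists>z. (x, z) \<in> parcs G \<and> h z = 2"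
  shows "sum f (pverts G) \<le> sum h (pverts G)"
proof -
  have "roman_dominating (with_proj G) h"
    unfolding roman_dominating_def using assms by (auto dest: in_arcsD2) (metis in_arcsD2)
  from roman_number_le[OF this] gamma_R show ?thesis
    by (simp add: gamma_R_function_def roman_weight_def)
qed

text \<open>Otherwise \<open>u\<close> could drop to 0, being dominated by \<open>v\<close>; no
  vertex relies on \<open>u\<close>, whose value is not 2.\<close>

lemma no_arc_B1_B2:
  assumes e: "(u, v) \<in> parcs G" and "f u = 1" "f v = 2"
  shows False
proof -
  have "sum f (pverts G) \<le> sum (f(u := 0)) (pverts G)"
  proof (rule f_minimal)
    fix x assume x: "x \<in> pverts G"
    show "(f(u := 0)) x \<in> {0, 1, 2}" using f_values[OF x] by auto
    assume "(f(u := 0)) x = 0"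
    then show "\<exists>z. (x, z) \<in> parcs G \<and> (f(u := 0)) z = 2"
    proof (cases "x = u")
      case True
      then show ?thesis using assms by (intro exI[of _ v]) auto
    next
      case False
      then have "f x = 0" using \<open>(f(u := 0)) x = 0\<close> by simp
      then obtain z where "(x, z) \<in> parcs G" "f z = 2" using f_dominates[OF x] by blast
      then show ?thesis using assms by (intro exI[of _ z]) auto
    qed
  qed
  then show False
    using sum_fun_upd[OF pair_finite_verts in_arcsD1[OF e], of f 0] assms by simp
qed

text \<open>Two distinct neighbours would allow the values 2, 0, 0 in place of 1, 1, 1, which saves
  1.\<close>

lemma B1_matching:
  assumes e: "(u, v) \<in> parcs G" "(u, w) \<in> parcs G" and 1: "f u = 1" "f v = 1" "f w = 1"
  shows "v = w"
proof (rule ccontr)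
  assume "v \<noteq> w"
  have ne: "u \<noteq> v" "u \<noteq> w" using e no_loops' by auto
  let ?h = "f(u := 2, v := 0, w := 0)"
  have "sum f (pverts G) \<le> sum ?h (pverts G)"
  proof (rule f_minimal)
    fix x assume x: "x \<in> pverts G"
    show "?h x \<in> {0, 1, 2}" using f_values[OF x] by auto
    assume h0: "?h x = 0"
    show "\<exists>z. (x, z) \<in> parcs G \<and> ?h z = 2"
    proof (cases "x = v \<or> x = w")
      case True
      then show ?thesis using ne e by (intro exI[of _ u]) (auto dest: arc_sym)
    next
      case False
      then have "f x = 0" using h0 by (auto split: if_splits)
      then obtain z where "(x, z) \<in> parcs G" "f z = 2" using f_dominates[OF x] by blast
      then show ?thesis using 1 by (intro exI[of _ z]) auto
    qed
  qed
  then show False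
    using sum_fun_upd[OF pair_finite_verts in_arcsD1[OF e(1)], of f 2]
      sum_fun_upd[OF pair_finite_verts in_arcsD2[OF e(1)], of "f(u := 2)" 0]
      sum_fun_upd[OF pair_finite_verts in_arcsD2[OF e(2)], of "f(u := 2, v := 0)" 0]
      1 ne \<open>v \<noteq> w\<close> by simp
qed

definition "D1 = {u \<in> pverts G. f u = 1 \<and> (\<exists>v. (u, v) \<in> parcs G \<and> f v = 1)}"

text \<open>Together with \<open>D1\<close> this makes up the \<open>D12\<close> of the
  theorem.\<close>

definition "D2 = {u \<in> pverts G. f u = 2 \<and> (\<exists>v. (u, v) \<in> parcs G \<and> f v = 2)}"

definition "Theta = {u \<in> pverts G. f u = 1 \<and> u \<notin> D1 \<and> (\<exists>v \<in> pverts G. f v = 2 \<and>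
  graph_dist (with_proj G) u v = 2 \<and> card {y \<in> pverts G. (v, y) \<in> parcs G \<and> f y = 0} = 2)}"

lemma Theta_witness:
  assumes "u \<in> Theta"
  shows "\<exists>v a b. v \<in> pverts G \<and> f v = 2 \<and> (u, a) \<in> parcs G \<and> (v, a) \<in> parcs G \<and>
    b \<in> pverts G \<and> f a = 0 \<and> f b = 0 \<and> a \<noteq> b \<and>
    (\<forall>y. (y, v) \<in> parcs G \<and> f y = 0 \<longrightarrow> y = a \<or> y = b)"
proof -
  from assms obtain v where v: "v \<in> pverts G" "f v = 2" "graph_dist (with_proj G) u v = 2"
      "card {y \<in> pverts G. (v, y) \<in> parcs G \<and> f y = 0} = 2" and u: "f u = 1" "u \<notin> D1" "u \<in> pverts G"
    by (auto simp: Theta_def)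
  \<comment> \<open>\<open>u = v\<close> contradicts the values 1 and 2, and an arc is excluded by
    \<open>no_arc_B1_B2\<close>, so a middle vertex remains.\<close>
  obtain a where a: "(u, a) \<in> parcs G" "(a, v) \<in> parcs G"
    using v(3) by (rule graph_dist_2_cases) (use v u no_arc_B1_B2 in auto)
  have aV: "a \<in> pverts G" using a in_arcsD1 by blast
  \<comment> \<open>The value 1 would put \<open>u\<close> into \<open>D1\<close>; the value 2 would
    join B1 to B2.\<close>
  have "f a \<noteq> 1" using a u by (auto simp: D1_def)
  moreover have "f a \<noteq> 2" using a u no_arc_B1_B2 by blast
  ultimately have fa: "f a = 0" using f_values[OF aV] by auto
  let ?N = "{y \<in> pverts G. (v, y) \<in> parcs G \<and> f y = 0}"
  have aN: "a \<in> ?N" using a fa aV arc_sym by auto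
  obtain c d where cd: "?N = {c, d}" "c \<noteq> d"
    using v(4) by (auto simp: card_2_iff)
  obtain b where b: "?N = {a, b}" "a \<noteq> b"
  proof (cases "a = c")
    case True
    then show ?thesis using cd that by blast
  next
    case False
    then have "a = d" using aN cd by blast
    then show ?thesis using cd that[of c] by (auto simp: insert_commute)
  qed
  have "b \<in> ?N" using b by blast
  moreover have "y = a \<or> y = b" if "(y, v) \<in> parcs G" "f y = 0" for y
  proof -
    have "y \<in> ?N" using that arc_sym in_arcsD1 by blast
    then show ?thesis using b by blast
  qed
  ultimately show ?thesis using v a fa b(2) arc_sym by blast
qed

section \<open>The function on pairs of letters\<close>

text \<open>The first conjunct of the dominance condition uses an edge \<open>xy - xz\<close>, the second one the
  edge \<open>xy - yx\<close>.\<close>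

lemma two_level_function:
  obtains g :: "'a \<Rightarrow> 'a \<Rightarrow> nat" where
    "\<And>x y. x \<in> pverts G \<Longrightarrow> y \<in> pverts G \<Longrightarrow> g x y \<in> {0, 1, 2}"
    "\<And>x y. x \<in> pverts G \<Longrightarrow> y \<in> pverts G \<Longrightarrow> g x y = 0 \<Longrightarrow>
      (\<exists>z. (y, z) \<in> parcs G \<and> g x z = 2) \<or> ((x, y) \<in> parcs G \<and> g y x = 2)"
    "2 * (\<Sum>x\<in>pverts G. \<Sum>y\<in>pverts G. g x y) + 2 * card {v \<in> pverts G. f v = 2} + 2 * card D2
      + 2 * card Theta + card D1 = 2 * card (pverts G) * sum f (pverts G)"
proof -
  let ?V = "pverts G"
  note fin = pair_finite_verts
  \<comment> \<open>One predicate for all conditions, so that the three witnesses are chosen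
    together as functions of \<open>u\<close>.\<close>
  define P where "P u v a b \<longleftrightarrow> v \<in> ?V \<and> f v = 2 \<and> (u, a) \<in> parcs G \<and> (v, a) \<in> parcs G \<and>
      b \<in> ?V \<and> f a = 0 \<and> f b = 0 \<and> a \<noteq> b \<and>
      (\<forall>y. (y, v) \<in> parcs G \<and> f y = 0 \<longrightarrow> y = a \<or> y = b)" for u v a b
  have "\<exists>v a b. P u v a b" if "u \<in> Theta" for u
    using Theta_witness[OF that] unfolding P_def .
  then obtain v a b where P: "P u (v u) (a u) (b u)" if "u \<in> Theta" for u
    by metis
  have Th: "v u \<in> ?V" "f (v u) = 2" "(u, a u) \<in> parcs G" "(v u, a u) \<in> parcs G"
      "b u \<in> ?V" "f (a u) = 0" "f (b u) = 0" "a u \<noteq> b u"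
      "(y, v u) \<in> parcs G \<Longrightarrow> f y = 0 \<Longrightarrow> y = a u \<or> y = b u"
    if "u \<in> Theta" for u y
    using P[OF that] unfolding P_def by blast+
  have Th_f: "u \<in> ?V" "f u = 1" "u \<notin> D1" if "u \<in> Theta" for u
    using that by (auto simp: Theta_def)
  have "\<exists>v. (u, v) \<in> parcs G \<and> f v = 1" if "u \<in> D1" for u
    using that by (auto simp: D1_def)
  then obtain p where p: "(u, p u) \<in> parcs G" "f (p u) = 1" if "u \<in> D1" for u
    by metis
  have D1_f: "u \<in> ?V" "f u = 1" if "u \<in> D1" for u
    using that by (auto simp: D1_def)
  have p_D1: "p u \<in> D1" if "u \<in> D1" for u
    using p[OF that] D1_f[OF that] arc_sym in_arcsD2 by (auto simp: D1_def)
  have pp: "p (p u) = u" if "u \<in> D1" for u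
    using B1_matching[OF p(1)[OF p_D1[OF that]] arc_sym[OF p(1)[OF that]]]
      p[OF that] p[OF p_D1[OF that]] D1_f[OF that] by simp
  have p_ne: "p u \<noteq> u" if "u \<in> D1" for u
    using p[OF that] no_loops' by metis
  \<comment> \<open>The two ends of a matched edge are treated differently; a numbering of the
    vertices decides which of \<open>u\<close> and \<open>p u\<close> goes into
    \<open>L\<close>.\<close>
  obtain ix :: "'a \<Rightarrow> nat" where ix: "inj_on ix ?V"
    using finite_imp_inj_to_nat_seg[OF fin] by blast
  have ix_p: "ix (p u) \<noteq> ix u" if "u \<in> D1" for u
    using inj_onD[OF ix, of "p u" u] p_ne[OF that] D1_f(1)[OF that] D1_f(1)[OF p_D1[OF that]]
    by blast
  define L where "L = {u \<in> D1. ix (p u) < ix u}"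
  \<comment> \<open>Row \<open>x\<close> of \<open>g\<close> lives on the copy of \<open>G\<close>
    with first letter \<open>x\<close>. Of the two rows of a matched edge, the one outside
    \<open>L\<close> receives the 2 and the one in \<open>L\<close> is lowered.\<close>
  define g where "g x = (if f x = 0 then (\<lambda>y. if y \<in> Theta \<and> a y = x then 0 else f y)
      else if f x = 2 then f(x := if x \<in> D2 then 0 else 1)
      else if x \<in> Theta then f(x := 0, v x := 0, a x := 2, b x := 1)
      else if x \<in> L then f(p x := 0)
      else if x \<in> D1 then f(x := 0, p x := 2)
      else f)" for x
  \<comment> \<open>The saving of row \<open>x\<close>. For \<open>u\<close> in \<open>Theta\<close>
    it is booked on row \<open>a u\<close>, where the entry at \<open>u\<close> drops; row
    \<open>u\<close> itself only redistributes its weight, and so do the rows of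
    \<open>D1 - L\<close>.\<close>
  define s where "s x = card {u \<in> Theta. a u = x} + of_bool (x \<in> {v \<in> ?V. f v = 2})
      + of_bool (x \<in> D2) + of_bool (x \<in> L)" for x

  have g0: "g x = (\<lambda>y. if y \<in> Theta \<and> a y = x then 0 else f y)" if "f x = 0" for x
    unfolding g_def using that by simp
  have g2: "g x = f(x := if x \<in> D2 then 0 else 1)" if "f x = 2" for x
    unfolding g_def using that by simp
  have gT: "g x = f(x := 0, v x := 0, a x := 2, b x := 1)" if "x \<in> Theta" for x
    unfolding g_def using that Th_f(2)[OF that] by simp
  have D1_T: "x \<notin> Theta" if "x \<in> D1" for x
    using that Th_f(3) by blast
  have gL: "g x = f(p x := 0)" if "x \<in> D1" "x \<in> L" for x
    unfolding g_def using that D1_f(2)[OF that(1)] D1_T[OF that(1)] by simp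
  have gD: "g x = f(x := 0, p x := 2)" if "x \<in> D1" "x \<notin> L" for x
    unfolding g_def using that D1_f(2)[OF that(1)] D1_T[OF that(1)] by simp
  have g1: "g x = f" if "f x = 1" "x \<notin> Theta" "x \<notin> D1" for x
    unfolding g_def L_def using that by simp

  have range: "g x y \<in> {0, 1, 2}" if "x \<in> ?V" "y \<in> ?V" for x y
  proof -
    have fy: "f y \<le> 2" using f_values[OF that(2)] by auto
    have upd: "(h(z := c)) y \<le> 2" if "h y \<le> 2" "c \<le> 2" for h z and c :: nat
      using that by simp
    have "g x y \<le> 2" unfolding g_def by (simp add: upd fy del: fun_upd_apply)
    then show ?thesis by (auto simp: le_Suc_eq numeral_2_eq_2)
  qed

  \<comment> \<open>Dominance\<close>
  have dom: "(\<exists>z. (y, z) \<in> parcs G \<and> g x z = 2) \<or> ((x, y) \<in> parcs G \<and> g y x = 2)"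
    if x: "x \<in> ?V" and y: "y \<in> ?V" and g0': "g x y = 0" for x y
  proof -
    \<comment> \<open>The default argument: a vertex dominating \<open>y\<close> under
      \<open>f\<close> still does so in row \<open>x\<close>, or the edge between \<open>xy\<close>
      and \<open>yx\<close> takes over.\<close>
    have f0: "(\<exists>z. (y, z) \<in> parcs G \<and> g x z = 2) \<or> ((x, y) \<in> parcs G \<and> g y x = 2)"
      if "f y = 0" and "\<And>z. (y, z) \<in> parcs G \<Longrightarrow> f z = 2 \<Longrightarrow>
        g x z = 2 \<or> ((x, y) \<in> parcs G \<and> g y x = 2)"
      using f_dominates[OF y that(1)] that(2) by metis
    consider (B0) "f x = 0" | (B2) "f x = 2" | (T) "x \<in> Theta" "f x = 1" "x \<notin> D1"
      | (L) "x \<in> D1" "x \<in> L" "f x = 1" | (D) "x \<in> D1" "x \<notin> L" "f x = 1"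
      | (R) "f x = 1" "x \<notin> Theta" "x \<notin> D1"
      using f_values[OF x] Th_f(3) by metis
    then show ?thesis
    proof cases
      case B0
      show ?thesis
      proof (cases "y \<in> Theta \<and> a y = x")
        case True
        then have "g y x = 2" using Th(8)[of y] by (auto simp: gT)
        then show ?thesis using True Th(3)[of y] arc_sym by blast
      next
        case False
        then have "f y = 0" using g0' B0 by (auto simp: g0 split: if_splits)
        \<comment> \<open>The lowered entries lie in \<open>Theta\<close>, where \<open>f\<close> is
          1, so row \<open>x\<close> keeps all its 2s.\<close>
        moreover have "g x z = 2" if "f z = 2" for z
          using that Th_f(2)[of z] B0 by (auto simp: g0)
        ultimately show ?thesis using f0 by blast
      qed
    next
      case B2
      show ?thesis
      proof (cases "y = x")
        case True
        then have "x \<in> D2" using g0' by (simp add: g2[OF B2] split: if_splits)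
        then obtain w where w: "(x, w) \<in> parcs G" "f w = 2" by (auto simp: D2_def)
        then have "g x w = 2" using no_loops'[of x w] by (simp add: g2[OF B2])
        then show ?thesis using True w by blast
      next
        case False
        then have fy: "f y = 0" using g0' by (simp add: g2[OF B2])
        show ?thesis
        proof (rule f0[OF fy])
          fix z assume z: "(y, z) \<in> parcs G" "f z = 2"
          show "g x z = 2 \<or> ((x, y) \<in> parcs G \<and> g y x = 2)"
          proof (cases "z = x")
            case True
            \<comment> \<open>The 2 lost at \<open>xx\<close> is replaced by the one at
              \<open>yx\<close>: row \<open>y\<close> lowers only entries in
              \<open>Theta\<close>.\<close>
            have "x \<notin> Theta" using Th_f(2)[of x] B2 by auto
            then show ?thesis using True z arc_sym B2 by (simp add: g0[OF fy])
          next
            case False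
            then show ?thesis using z by (simp add: g2[OF B2])
          qed
        qed
      qed
    next
      case T
      note W = Th[OF T(1)]
      have gx: "g x = f(x := 0, v x := 0, a x := 2, b x := 1)" by (rule gT[OF T(1)])
      have gxa: "g x (a x) = 2" using W(8) by (simp add: gx)
      consider "y = x" | "y = v x" | "y \<noteq> x" "y \<noteq> v x" by blast
      then show ?thesis
      proof cases
        case 1
        then show ?thesis using W(3) gxa by blast
      next
        case 2
        then show ?thesis using W(4) gxa by blast
      next
        case 3
        then have yab: "y \<noteq> b x" "y \<noteq> a x" "f y = 0"
          using g0' by (simp_all add: gx fun_upd_apply split: if_splits)
        show ?thesis
        proof (rule f0[OF yab(3)])
          fix z assume z: "(y, z) \<in> parcs G" "f z = 2"
          \<comment> \<open>Losing the 2 at \<open>v x\<close> is harmless: its only neighbours in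
            B0 are \<open>a x\<close> and \<open>b x\<close>, both positive in row
            \<open>x\<close>.\<close>
          have "z \<noteq> v x" using W(9)[of y] yab z by blast
          moreover have "z \<noteq> x" "z \<noteq> a x" "z \<noteq> b x" using z T W(6,7) by auto
          ultimately show "g x z = 2 \<or> ((x, y) \<in> parcs G \<and> g y x = 2)" using z by (simp add: gx)
        qed
      qed
    next
      case L
      note D = L(1)
      show ?thesis
      proof (cases "y = p x")
        case True
        \<comment> \<open>As \<open>p x\<close> is the end outside \<open>L\<close>, its row carries
          a 2 at \<open>p (p x) = x\<close>.\<close>
        have "p x \<notin> L" using L(2) pp[OF D] by (simp add: L_def)
        then have "g (p x) x = 2"
          using pp[OF D] by (simp add: gD[OF p_D1[OF D]])
        then show ?thesis using True p(1)[OF D] by blast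
      next
        case False
        then have fy: "f y = 0" using g0' by (simp add: gL[OF L(1,2)])
        have "g x z = 2" if "f z = 2" for z
          using that p(2)[OF D] by (auto simp: gL[OF L(1,2)])
        then show ?thesis using f0[OF fy] by blast
      qed
    next
      case D
      show ?thesis
      proof (cases "y = x")
        case True
        have "g x (p x) = 2" by (simp add: gD[OF D(1,2)])
        then show ?thesis using p(1)[OF D(1)] True by blast
      next
        case False
        then have fy: "f y = 0" using g0' by (simp add: gD[OF D(1,2)] split: if_splits)
        have "g x z = 2" if "f z = 2" for z
          using that D(3) by (auto simp: gD[OF D(1,2)])
        then show ?thesis using f0[OF fy] by blast
      qed
    next
      case R
      then have "f y = 0" using g0' by (simp add: g1)
      then show ?thesis using f0 R by (simp add: g1)
    qed
  qed

  \<comment> \<open>Weight of each row\<close>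
  have B0_a: "card {u \<in> Theta. a u = x} = 0" if "f x \<noteq> 0" for x
  proof -
    have "{u \<in> Theta. a u = x} = {}" using that Th(6) by auto
    then show ?thesis by (metis card.empty)
  qed
  have D1_s: "s x = of_bool (x \<in> L)" if "f x = 1" for x
    using that by (simp add: s_def B0_a D2_def)

  have copy: "sum (g x) ?V + s x = sum f ?V" if x: "x \<in> ?V" for x
  proof -
    consider (B0) "f x = 0" | (B2) "f x = 2" | (T) "x \<in> Theta" "f x = 1" "x \<notin> D1"
      | (L) "x \<in> D1" "x \<in> L" "f x = 1" | (D) "x \<in> D1" "x \<notin> L" "f x = 1"
      | (R) "f x = 1" "x \<notin> Theta" "x \<notin> D1"
      using f_values[OF x] Th_f(3) by metis
    then show ?thesis
    proof cases
      case B0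
      let ?S = "{u \<in> Theta. a u = x}"
      have S: "?S \<subseteq> ?V" using Th_f(1) by blast
      have "x \<notin> L" using B0 D1_f(2)[of x] by (auto simp: L_def)
      then have "s x = card ?S" using B0 by (simp add: s_def D2_def)
      \<comment> \<open>Each lowered entry had the value 1, so \<open>of_bool\<close> restores it
        exactly.\<close>
      moreover have "sum f ?V = (\<Sum>y\<in>?V. g x y + of_bool (y \<in> ?S))"
        by (rule sum.cong) (use Th_f(2) in \<open>auto simp: g0[OF B0]\<close>)
      ultimately show ?thesis
        using sum_of_bool_eq_card[OF fin S] by (simp add: sum.distrib)
    next
      case B2
      have "x \<notin> L" using B2 D1_f(2)[of x] by (auto simp: L_def)
      then have "s x = 1 + of_bool (x \<in> D2)" using B2 x by (simp add: s_def B0_a)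
      then show ?thesis
        using sum_fun_upd[OF fin x, of f "if x \<in> D2 then 0 else 1"] B2
        by (simp add: g2[OF B2] split: if_splits)
    next
      case T
      note W = Th[OF T(1)]
      have aV: "a x \<in> ?V" using W(3) in_arcsD2 by blast
      have "x \<notin> L" using T(3) by (simp add: L_def)
      \<comment> \<open>The values 1, 2, 0, 0 separate these vertices, except \<open>a x\<close> and
        \<open>b x\<close>, distinct by choice. Hence the changes -1, -2, +2, +1 are independent and
        cancel.\<close>
      have "x \<noteq> v x" "x \<noteq> a x" "x \<noteq> b x" "v x \<noteq> a x" "v x \<noteq> b x" "a x \<noteq> b x"
        using T(2) W(2,6,7,8) by auto
      then show ?thesis
        using sum_fun_upd[OF fin x, of f 0]
          sum_fun_upd[OF fin W(1), of "f(x := 0)" 0]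
          sum_fun_upd[OF fin aV, of "f(x := 0, v x := 0)" 2]
          sum_fun_upd[OF fin W(5), of "f(x := 0, v x := 0, a x := 2)" 1]
          W(2,6,7) T(2) D1_s[OF T(2)] \<open>x \<notin> L\<close> by (simp add: gT[OF T(1)])
    next
      case L
      then show ?thesis
        using sum_fun_upd[OF fin D1_f(1)[OF p_D1[OF L(1)]], of f 0] p(2)[OF L(1)] D1_s[OF L(3)]
        by (simp add: gL)
    next
      case D
      then show ?thesis
        using sum_fun_upd[OF fin x, of f 0]
          sum_fun_upd[OF fin D1_f(1)[OF p_D1[OF D(1)]], of "f(x := 0)" 2]
          p(2)[OF D(1)] p_ne[OF D(1)] D1_s[OF D(3)]
        by (simp add: gD)
    next
      case R
      then show ?thesis using D1_s[OF R(1)] by (simp add: g1 L_def)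
    qed
  qed

  \<comment> \<open>Total saving\<close>
  have finD1: "finite D1" and finTh: "finite Theta"
    using fin by (auto simp: D1_def Theta_def)
  \<comment> \<open>The involution \<open>p\<close> of \<open>D1\<close> reverses the comparison of
    numbers, so it swaps \<open>L\<close> and \<open>D1 - L\<close>.\<close>
  have "bij_betw p L (D1 - L)"
  proof (rule bij_betw_byWitness[where f' = p])
    show "p ` (D1 - L) \<subseteq> L"
      using ix_p pp p_D1 by (fastforce simp: L_def)
  qed (use pp p_D1 in \<open>fastforce simp: L_def\<close>)+
  then have "card L = card (D1 - L)" by (rule bij_betw_same_card)
  moreover have "card (D1 - L) = card D1 - card L" "card L \<le> card D1"
    using finD1 by (auto simp: L_def intro!: card_Diff_subset card_mono)
  ultimately have L: "2 * card L = card D1" by simp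

  \<comment> \<open>The fibres of \<open>a\<close> partition \<open>Theta\<close>.\<close>
  have "(\<Sum>x\<in>?V. card {u \<in> Theta. a u = x}) = (\<Sum>x\<in>?V. \<Sum>u\<in>{u \<in> Theta. a u = x}. 1)"
    by simp
  also have "\<dots> = (\<Sum>u\<in>Theta. 1)"
    by (rule sum.group[OF finTh fin]) (use Th(3) in_arcsD2 in blast)
  finally have "sum s ?V = card Theta + card {v \<in> ?V. f v = 2} + card D2 + card L"
    unfolding s_def sum.distrib
    by (subst (1 2 3) sum_of_bool_eq_card[OF fin]) (auto simp: D2_def L_def D1_def)
  moreover have "(\<Sum>x\<in>?V. sum (g x) ?V) + sum s ?V = card ?V * sum f ?V"
    using copy by (simp add: sum.distrib[symmetric])
  ultimately have "2 * (\<Sum>x\<in>?V. sum (g x) ?V) + 2 * card {v \<in> ?V. f v = 2} + 2 * card D2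
      + 2 * card Theta + card D1 = 2 * card ?V * sum f ?V"
    using L by simp
  with that[of g] range dom show thesis by blast
qed

section \<open>Non-isolated vertices of the induced subgraphs\<close>

lemma mem_induced_non_isolated:
  assumes "A \<subseteq> pverts G"
  shows "u \<in> non_isolated (with_proj G \<restriction> A) \<longleftrightarrow> u \<in> A \<and> (\<exists>v\<in>A. (u, v) \<in> parcs G)"
  by (force simp: non_isolated_def nbhd_def arcs_ends_conv)

lemma non_isolated_B1:
  "non_isolated (with_proj G \<restriction> {v \<in> pverts G. f v = 1}) = D1"
  by (rule set_eqI, subst mem_induced_non_isolated) (auto simp: D1_def dest: in_arcsD2)

text \<open>By \<open>no_arc_B1_B2\<close>, applied in both directions, each arc inside the union
  joins vertices of equal value, so the set splits into two disjoint parts.\<close>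

lemma card_non_isolated_B1_B2:
  "card (non_isolated (with_proj G \<restriction> ({v \<in> pverts G. f v = 1} \<union> {v \<in> pverts G. f v = 2})))
    = card D1 + card D2"
proof -
  have "non_isolated (with_proj G \<restriction> ({v \<in> pverts G. f v = 1} \<union> {v \<in> pverts G. f v = 2})) = D1 \<union> D2"
    by (rule set_eqI, subst mem_induced_non_isolated)
      (auto simp: D1_def D2_def dest: in_arcsD2 no_arc_B1_B2 no_arc_B1_B2[OF arc_sym])
  moreover have "card (D1 \<union> D2) = card D1 + card D2"
    using pair_finite_verts by (intro card_Un_disjoint) (auto simp: D1_def D2_def)
  ultimately show ?thesis by simp
qed

end

theorem theorem6:
  fixes G :: "'a pair_pre_digraph" and f :: "'a \<Rightarrow> nat" and t n :: nat
    and B0 B1 B2 D1 D12 :: "'a set" and \<theta> :: nat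
  assumes "pair_graph G" and "n = card (pverts G)" and "n \<ge> 2"
    and "gamma_R_function (with_proj G) f" and "t \<ge> 2"
    and "B0 = {v \<in> pverts G. f v = 0}"
    and "B1 = {v \<in> pverts G. f v = 1}"
    and "B2 = {v \<in> pverts G. f v = 2}"
    and "D1 = non_isolated (with_proj G \<restriction> B1)"
    and "D12 = non_isolated (with_proj G \<restriction> (B1 \<union> B2))"
    and "\<theta> = card {u \<in> B1 - D1. \<exists>v \<in> B2.
           graph_dist (with_proj G) u v = 2 \<and> card (nbhd (with_proj G) v \<inter> B0) = 2}"
  shows "real (roman_number (with_proj (sierpinski G t))) \<le>
    real n ^ (t - 2) *
      (real n * real (roman_number (with_proj G)) - real (card B2) - real (card D12)
        - real \<theta> + 1 / 2 * real (card D1))"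
proof -
  interpret R: gamma_R_graph G f
    using assms(1,4) by (simp add: gamma_R_graph_def gamma_R_graph_axioms_def)
  have D1: "D1 = R.D1" using assms R.non_isolated_B1 by simp
  have D12: "card D12 = card R.D1 + card R.D2" using assms R.card_non_isolated_B1_B2 by simp
  have "nbhd (with_proj G) v \<inter> B0 = {y \<in> pverts G. (v, y) \<in> parcs G \<and> f y = 0}" for v
    using assms(6) by (auto simp: nbhd_def)
  then have theta: "\<theta> = card R.Theta"
    unfolding assms(11) R.Theta_def D1 assms(7,8)
    by (intro arg_cong[where f = card]) auto
  have gamma: "roman_number (with_proj G) = sum f (pverts G)"
    using assms(4) by (simp add: gamma_R_function_def roman_weight_def)
  obtain g :: "'a \<Rightarrow> 'a \<Rightarrow> nat" where
    g: "\<And>x y. x \<in> pverts G \<Longrightarrow> y \<in> pverts G \<Longrightarrow> g x y \<in> {0, 1, 2}"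
    "\<And>x y. x \<in> pverts G \<Longrightarrow> y \<in> pverts G \<Longrightarrow> g x y = 0 \<Longrightarrow>
      (\<exists>z. (y, z) \<in> parcs G \<and> g x z = 2) \<or> ((x, y) \<in> parcs G \<and> g y x = 2)"
    and weight: "2 * (\<Sum>x\<in>pverts G. \<Sum>y\<in>pverts G. g x y) + 2 * card {v \<in> pverts G. f v = 2}
      + 2 * card R.D2 + 2 * card R.Theta + card R.D1 = 2 * card (pverts G) * sum f (pverts G)"
    using R.two_level_function by blast
  let ?W = "\<Sum>x\<in>pverts G. \<Sum>y\<in>pverts G. g x y"
  have t: "t - 2 + 2 = t" using assms(5) by simp
  have "roman_number (with_proj (sierpinski G t)) \<le> n ^ (t - 2) * ?W"
    using R.roman_number_sierpinski_le[OF g, of "t - 2"] unfolding t assms(2) .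
  then have "real (roman_number (with_proj (sierpinski G t))) \<le> real n ^ (t - 2) * real ?W"
    by (metis of_nat_le_iff of_nat_mult of_nat_power)
  \<comment> \<open>Halving \<open>weight\<close> gives the savings \<open>card D2\<close> and half
    of \<open>card D1\<close>, one per matched edge; this equals \<open>card D12\<close> minus half
    of \<open>card D1\<close>.\<close>
  also have "real ?W = real n * real (roman_number (with_proj G)) - real (card B2) - real (card D12)
        - real \<theta> + 1 / 2 * real (card D1)"
    using arg_cong[OF weight, of real] unfolding gamma theta D1 D12 assms(2,8) by simp
  finally show ?thesis .
qed

end
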